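(* $\mathcal{G}_4\ne\Theta_4$.
   Context: A correlation matrix is a complex, positive semidefinite matrix having all diagonal entries equal to $1$; $\Theta_n$ denotes the set of all $n\times n$ correlation matrices. $\mathcal{G}_n$ is the set of all $n\times n$ matrices of the form $X=\big(\tau(U_i^*U_j)\big)_{1\le i,j\le n}$ as $(U_1,\ldots,U_n)$ runs over all $n$-tuples of unitaries in all (unital) $C^*$-algebras $A$ possessing a faithful tracial state $\tau$. *)

theory Defs
  imports "Jordan_Normal_Form.Matrix" "HOL-Library.Countable"
begin

section \<open>Correlation matrices\<close>

text \<open>The order on \<open>complex\<close> is the one with \<open>0 \<le> z\<close> iff \<open>z\<close> is a non-negative real number.\<close>

definition positive_semidefinite :: "nat \<Rightarrow> complex mat \<Rightarrow> bool" where
  "positive_semidefinite n X \<longleftrightarrow>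
     X \<in> carrier_mat n n \<and> (\<forall>v \<in> carrier_vec n. 0 \<le> (X *\<^sub>v v) \<bullet>c v)"

definition correlation_matrices :: "nat \<Rightarrow> complex mat set" where
  "correlation_matrices n =
     {X. positive_semidefinite n X \<and> (\<forall>i<n. X $$ (i, i) = 1)}"

section \<open>Unital C*-algebras with a faithful tracial state\<close>

record 'a star_struct = "(complex, 'a) module" +
  adj :: "'a \<Rightarrow> 'a"
  nrm :: "'a \<Rightarrow> real"

text \<open>All the axioms of a unital C*-algebra except completeness.\<close>

locale pre_cstar_algebra = ring A for A :: "('a, 'm) star_struct_scheme" (structure) +
  assumes smult_closed [simp, intro]: "x \<in> carrier A \<Longrightarrow> c \<odot> x \<in> carrier A"
    and smult_l_distr: "x \<in> carrier A \<Longrightarrow> (c + d) \<odot> x = c \<odot> x \<oplus> d \<odot> x"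
    and smult_r_distr: "\<lbrakk>x \<in> carrier A; y \<in> carrier A\<rbrakk> \<Longrightarrow> c \<odot> (x \<oplus> y) = c \<odot> x \<oplus> c \<odot> y"
    and smult_assoc: "x \<in> carrier A \<Longrightarrow> (c * d) \<odot> x = c \<odot> (d \<odot> x)"
    and smult_one [simp]: "x \<in> carrier A \<Longrightarrow> 1 \<odot> x = x"
    and smult_mult_l: "\<lbrakk>x \<in> carrier A; y \<in> carrier A\<rbrakk> \<Longrightarrow> (c \<odot> x) \<otimes> y = c \<odot> (x \<otimes> y)"
    and smult_mult_r: "\<lbrakk>x \<in> carrier A; y \<in> carrier A\<rbrakk> \<Longrightarrow> x \<otimes> (c \<odot> y) = c \<odot> (x \<otimes> y)"
    and adj_closed [simp, intro]: "x \<in> carrier A \<Longrightarrow> adj A x \<in> carrier A"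
    and adj_adj [simp]: "x \<in> carrier A \<Longrightarrow> adj A (adj A x) = x"
    and adj_add: "\<lbrakk>x \<in> carrier A; y \<in> carrier A\<rbrakk> \<Longrightarrow> adj A (x \<oplus> y) = adj A x \<oplus> adj A y"
    and adj_smult: "x \<in> carrier A \<Longrightarrow> adj A (c \<odot> x) = cnj c \<odot> adj A x"
    and adj_mult: "\<lbrakk>x \<in> carrier A; y \<in> carrier A\<rbrakk> \<Longrightarrow> adj A (x \<otimes> y) = adj A y \<otimes> adj A x"
    and nrm_nonneg: "x \<in> carrier A \<Longrightarrow> 0 \<le> nrm A x"
    and nrm_eq_0: "x \<in> carrier A \<Longrightarrow> nrm A x = 0 \<longleftrightarrow> x = \<zero>"
    and nrm_triangle: "\<lbrakk>x \<in> carrier A; y \<in> carrier A\<rbrakk> \<Longrightarrow> nrm A (x \<oplus> y) \<le> nrm A x + nrm A y"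
    and nrm_smult: "x \<in> carrier A \<Longrightarrow> nrm A (c \<odot> x) = cmod c * nrm A x"
    and nrm_mult: "\<lbrakk>x \<in> carrier A; y \<in> carrier A\<rbrakk> \<Longrightarrow> nrm A (x \<otimes> y) \<le> nrm A x * nrm A y"
    and cstar_identity: "x \<in> carrier A \<Longrightarrow> nrm A (adj A x \<otimes> x) = (nrm A x)\<^sup>2"

locale cstar_algebra = pre_cstar_algebra A for A :: "('a, 'm) star_struct_scheme" (structure) +
  assumes complete: "\<And>s :: nat \<Rightarrow> 'a.
    \<lbrakk>\<And>k. s k \<in> carrier A;
      \<And>e. 0 < e \<Longrightarrow> \<exists>N. \<forall>k\<ge>N. \<forall>l\<ge>N. nrm A (s k \<ominus> s l) < e\<rbrakk>
     \<Longrightarrow> \<exists>x \<in> carrier A. \<forall>e>0. \<exists>N. \<forall>k\<ge>N. nrm A (s k \<ominus> x) < e"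

text \<open>The positive elements of a C*-algebra are those of the form \<open>adj A x \<otimes> x\<close>; a state on a
  unital C*-algebra is a positive linear functional taking the value 1 at the identity.\<close>

locale faithful_tracial_state = cstar_algebra A for A :: "('a, 'm) star_struct_scheme" (structure) +
  fixes \<tau> :: "'a \<Rightarrow> complex"
  assumes trace_add: "\<lbrakk>x \<in> carrier A; y \<in> carrier A\<rbrakk> \<Longrightarrow> \<tau> (x \<oplus> y) = \<tau> x + \<tau> y"
    and trace_smult: "x \<in> carrier A \<Longrightarrow> \<tau> (c \<odot> x) = c * \<tau> x"
    and trace_pos: "x \<in> carrier A \<Longrightarrow> 0 \<le> \<tau> (adj A x \<otimes> x)"
    and trace_one: "\<tau> \<one> = 1"
    and trace_comm: "\<lbrakk>x \<in> carrier A; y \<in> carrier A\<rbrakk> \<Longrightarrow> \<tau> (x \<otimes> y) = \<tau> (y \<otimes> x)"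
    and trace_faithful: "\<lbrakk>x \<in> carrier A; \<tau> (adj A x \<otimes> x) = 0\<rbrakk> \<Longrightarrow> x = \<zero>"

definition unitaries :: "('a, 'm) star_struct_scheme \<Rightarrow> 'a set" where
  "unitaries A = {u \<in> carrier A. adj A u \<otimes>\<^bsub>A\<^esub> u = \<one>\<^bsub>A\<^esub> \<and> u \<otimes>\<^bsub>A\<^esub> adj A u = \<one>\<^bsub>A\<^esub>}"

section \<open>Matrices of second-order moments of unitaries\<close>

definition moment_mat ::
  "('a, 'm) star_struct_scheme \<Rightarrow> ('a \<Rightarrow> complex) \<Rightarrow> nat \<Rightarrow> (nat \<Rightarrow> 'a) \<Rightarrow> complex mat" where
  "moment_mat A \<tau> n U = mat n n (\<lambda>(i, j). \<tau> (adj A (U i) \<otimes>\<^bsub>A\<^esub> U j))"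

text \<open>A set comprehension cannot range over C*-algebras on arbitrary types, so the carriers are
  taken to be subsets of \<open>nat \<Rightarrow> real\<close>. This loses nothing: by \<open>moment_mat_in_unitary_moments\<close>
  below, the moment matrices coming from an algebra over any type belong to this set, because the
  C*-subalgebra generated by finitely many elements is separable.\<close>

definition unitary_moments :: "nat \<Rightarrow> complex mat set" where
  "unitary_moments n =
     {moment_mat A \<tau> n U | (A :: (nat \<Rightarrow> real) star_struct) \<tau> U.
        faithful_tracial_state A \<tau> \<and> (\<forall>i<n. U i \<in> unitaries A)}"

subsection \<open>Independence of the choice of the underlying type\<close>

context pre_cstar_algebra
begin

lemma smult_0: "x \<in> carrier A \<Longrightarrow> 0 \<odot> x = \<zero>"
  using smult_l_distr[of x 0 0] by (metis add.l_cancel_one' add_0 smult_closed)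

lemma minus_smult: "x \<in> carrier A \<Longrightarrow> \<ominus> x = (-1) \<odot> x"
  using smult_l_distr[of x "-1" 1] smult_0[of x]
  by (metis add.inv_equality add.left_inverse smult_closed smult_one)

lemma nrm_minus: "x \<in> carrier A \<Longrightarrow> nrm A (\<ominus> x) = nrm A x"
  by (simp add: minus_smult nrm_smult)

lemma adj_minus: "x \<in> carrier A \<Longrightarrow> adj A (\<ominus> x) = \<ominus> adj A x"
  by (simp add: minus_smult adj_smult)

lemma smult_minus: "x \<in> carrier A \<Longrightarrow> c \<odot> (\<ominus> x) = \<ominus> (c \<odot> x)"
  by (simp add: minus_smult flip: smult_assoc)

lemma adj_one: "adj A \<one> = \<one>"
  by (metis adj_adj adj_closed adj_mult one_closed r_one l_one)

lemma nrm_adj_le: 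
  assumes x: "x \<in> carrier A" shows "nrm A x \<le> nrm A (adj A x)"
proof (cases "nrm A x = 0")
  case False
  have "(nrm A x)\<^sup>2 \<le> nrm A (adj A x) * nrm A x"
    using x nrm_mult[of "adj A x" x] cstar_identity[OF x] by simp
  with False nrm_nonneg[OF x] show ?thesis
    by (simp add: power2_eq_square)
qed (use x in \<open>simp add: nrm_nonneg\<close>)

lemma nrm_adj: "x \<in> carrier A \<Longrightarrow> nrm A (adj A x) = nrm A x"
  using nrm_adj_le[of x] nrm_adj_le[of "adj A x"] by simp

lemma nrm_sub_commute:
  assumes "x \<in> carrier A" "y \<in> carrier A" shows "nrm A (x \<ominus> y) = nrm A (y \<ominus> x)"
proof -
  have "\<ominus> (x \<ominus> y) = y \<ominus> x"
    using assms by (simp add: a_minus_def minus_add a_comm)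
  with assms show ?thesis by (metis minus_closed nrm_minus)
qed

lemma nrm_sub_triangle:
  assumes [simp]: "x \<in> carrier A" "y \<in> carrier A" "z \<in> carrier A"
  shows "nrm A (x \<ominus> z) \<le> nrm A (x \<ominus> y) + nrm A (y \<ominus> z)"
proof -
  have "x \<ominus> z = (x \<ominus> y) \<oplus> (y \<ominus> z)"
    by (simp add: a_minus_def a_assoc r_neg1)
  then show ?thesis using nrm_triangle[of "x \<ominus> y" "y \<ominus> z"] by simp
qed

lemma nrm_add_sub_add:
  assumes [simp]: "x \<in> carrier A" "y \<in> carrier A" "x' \<in> carrier A" "y' \<in> carrier A"
  shows "nrm A ((x \<oplus> y) \<ominus> (x' \<oplus> y')) \<le> nrm A (x \<ominus> x') + nrm A (y \<ominus> y')"
proof -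
  have "(x \<oplus> y) \<ominus> (x' \<oplus> y') = (x \<ominus> x') \<oplus> (y \<ominus> y')"
    by (simp add: a_minus_def minus_add a_ac)
  then show ?thesis using nrm_triangle[of "x \<ominus> x'" "y \<ominus> y'"] by simp
qed

lemma nrm_mult_sub_mult:
  assumes [simp]: "x \<in> carrier A" "y \<in> carrier A" "x' \<in> carrier A" "y' \<in> carrier A"
  shows "nrm A ((x \<otimes> y) \<ominus> (x' \<otimes> y')) \<le>
    nrm A (x \<ominus> x') * nrm A y + (nrm A x + nrm A (x \<ominus> x')) * nrm A (y \<ominus> y')"
proof -
  have 1: "(x \<otimes> y) \<ominus> (x' \<otimes> y') = (x \<ominus> x') \<otimes> y \<oplus> x' \<otimes> (y \<ominus> y')"
    by (simp add: a_minus_def l_distr r_distr l_minus r_minus a_assoc r_neg1)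
  have 2: "nrm A x' \<le> nrm A x + nrm A (x \<ominus> x')"
    using nrm_sub_triangle[of x' x \<zero>] nrm_sub_commute[of x x'] by (simp add: a_minus_def)
  have "nrm A ((x \<otimes> y) \<ominus> (x' \<otimes> y')) \<le>
    nrm A ((x \<ominus> x') \<otimes> y) + nrm A (x' \<otimes> (y \<ominus> y'))"
    unfolding 1 by (rule nrm_triangle) auto
  also have "\<dots> \<le> nrm A (x \<ominus> x') * nrm A y + nrm A x' * nrm A (y \<ominus> y')"
    by (intro add_mono nrm_mult) auto
  also have "\<dots> \<le> nrm A (x \<ominus> x') * nrm A y + (nrm A x + nrm A (x \<ominus> x')) * nrm A (y \<ominus> y')"
    by (intro add_mono mult_right_mono 2 nrm_nonneg) auto
  finally show ?thesis .
qed

lemma nrm_smult_sub_smult: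
  assumes [simp]: "x \<in> carrier A" "x' \<in> carrier A"
  shows "nrm A ((c \<odot> x) \<ominus> (c' \<odot> x')) \<le>
    cmod (c - c') * nrm A x + (cmod c + cmod (c - c')) * nrm A (x \<ominus> x')"
proof -
  have "c \<odot> x = (c - c') \<odot> x \<oplus> c' \<odot> x"
    by (simp flip: smult_l_distr)
  then have 1: "(c \<odot> x) \<ominus> (c' \<odot> x') = (c - c') \<odot> x \<oplus> c' \<odot> (x \<ominus> x')"
    by (simp add: a_minus_def smult_r_distr smult_minus a_assoc)
  have "cmod c' \<le> cmod c + cmod (c - c')"
    using norm_triangle_ineq4[of c "c - c'"] by simp
  have "nrm A ((c \<odot> x) \<ominus> (c' \<odot> x')) \<le> nrm A ((c - c') \<odot> x) + nrm A (c' \<odot> (x \<ominus> x'))"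
    unfolding 1 by (rule nrm_triangle) auto
  also have "\<dots> = cmod (c - c') * nrm A x + cmod c' * nrm A (x \<ominus> x')"
    by (simp add: nrm_smult)
  also have "\<dots> \<le> cmod (c - c') * nrm A x + (cmod c + cmod (c - c')) * nrm A (x \<ominus> x')"
    by (intro add_mono mult_right_mono \<open>cmod c' \<le> _\<close> nrm_nonneg) auto
  finally show ?thesis .
qed

end

definition restrict_transport ::
  "'a set \<Rightarrow> ('a \<Rightarrow> 'b) \<Rightarrow> ('a, 'm) star_struct_scheme \<Rightarrow> 'b star_struct" where
  "restrict_transport B f A = (let g = the_inv_into B f in
    \<lparr>carrier = f ` B,
     mult = (\<lambda>x y. f (g x \<otimes>\<^bsub>A\<^esub> g y)), one = f \<one>\<^bsub>A\<^esub>,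
     zero = f \<zero>\<^bsub>A\<^esub>, add = (\<lambda>x y. f (g x \<oplus>\<^bsub>A\<^esub> g y)),
     smult = (\<lambda>c x. f (c \<odot>\<^bsub>A\<^esub> g x)),
     adj = (\<lambda>x. f (adj A (g x))), nrm = (\<lambda>x. nrm A (g x))\<rparr>)"

locale closed_star_subalgebra = faithful_tracial_state A \<tau>
  for A :: "('a, 'm) star_struct_scheme" (structure) and \<tau> +
  fixes B :: "'a set" and f :: "'a \<Rightarrow> 'c"
  assumes sub: "B \<subseteq> carrier A"
    and inj: "inj_on f B"
    and zero_B [simp]: "\<zero> \<in> B" and one_B [simp]: "\<one> \<in> B"
    and add_B [simp]: "\<lbrakk>x \<in> B; y \<in> B\<rbrakk> \<Longrightarrow> x \<oplus> y \<in> B"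
    and mult_B [simp]: "\<lbrakk>x \<in> B; y \<in> B\<rbrakk> \<Longrightarrow> x \<otimes> y \<in> B"
    and smult_B [simp]: "x \<in> B \<Longrightarrow> c \<odot> x \<in> B"
    and adj_B [simp]: "x \<in> B \<Longrightarrow> adj A x \<in> B"
    and closed_B: "\<lbrakk>x \<in> carrier A; \<And>e. 0 < e \<Longrightarrow> \<exists>y\<in>B. nrm A (y \<ominus> x) < e\<rbrakk> \<Longrightarrow> x \<in> B"
begin

abbreviation "g \<equiv> the_inv_into B f"
abbreviation "T \<equiv> restrict_transport B f A"

lemma gf [simp]: "x \<in> B \<Longrightarrow> g (f x) = x"
  using inj by (rule the_inv_into_f_f)

lemma feq [simp]: "\<lbrakk>x \<in> B; y \<in> B\<rbrakk> \<Longrightarrow> f x = f y \<longleftrightarrow> x = y"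
  using inj by (auto simp: inj_on_def)

lemma BA [simp]: "x \<in> B \<Longrightarrow> x \<in> carrier A"
  using sub by auto

lemma T_simps [simp]:
  "carrier T = f ` B" "one T = f \<one>" "zero T = f \<zero>"
  "mult T x y = f (g x \<otimes> g y)" "add T x y = f (g x \<oplus> g y)"
  "smult T c x = f (c \<odot> g x)" "adj T x = f (adj A (g x))" "nrm T x = nrm A (g x)"
  by (simp_all add: restrict_transport_def Let_def)

lemma minus_B [simp]: "x \<in> B \<Longrightarrow> \<ominus> x \<in> B"
  by (simp add: minus_smult)

lemma sub_B [simp]: "\<lbrakk>x \<in> B; y \<in> B\<rbrakk> \<Longrightarrow> x \<ominus> y \<in> B"
  by (simp add: a_minus_def)

lemma ring_T: "ring T"
proof (intro ringI abelian_groupI monoidI)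
  fix x assume "x \<in> carrier T"
  then show "\<exists>y\<in>carrier T. y \<oplus>\<^bsub>T\<^esub> x = \<zero>\<^bsub>T\<^esub>"
    by (auto intro!: bexI[of _ "\<ominus> (g x)"] simp: l_neg)
qed (auto simp: a_ac m_assoc l_distr r_distr)

lemma pre_T: "pre_cstar_algebra T"
proof (intro pre_cstar_algebra.intro ring_T pre_cstar_algebra_axioms.intro)
qed (auto simp: smult_l_distr smult_r_distr smult_assoc smult_mult_l smult_mult_r
    adj_add adj_smult adj_mult nrm_nonneg nrm_eq_0 nrm_triangle nrm_smult nrm_mult cstar_identity)

lemma minus_T:
  assumes "x \<in> B" "y \<in> B"
  shows "f x \<ominus>\<^bsub>T\<^esub> f y = f (x \<ominus> y)"
proof -
  interpret T: pre_cstar_algebra T by (rule pre_T)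
  show ?thesis using assms
    by (simp add: a_minus_def T.minus_smult minus_smult)
qed

lemma cstar_T: "cstar_algebra T"
proof (intro cstar_algebra.intro pre_T cstar_algebra_axioms.intro)
  fix s assume s: "\<And>k::nat. s k \<in> carrier T"
    and Cau: "\<And>e. 0 < e \<Longrightarrow> \<exists>N. \<forall>k\<ge>N. \<forall>l\<ge>N. nrm T (s k \<ominus>\<^bsub>T\<^esub> s l) < e"
  define r where "r = g \<circ> s"
  have r: "r k \<in> B" "s k = f (r k)" for k
    using s[of k] by (auto simp: r_def)
  have "\<exists>x \<in> carrier A. \<forall>e>0. \<exists>N. \<forall>k\<ge>N. nrm A (r k \<ominus> x) < e"
    by (rule complete) (use Cau r in \<open>simp_all add: minus_T\<close>)
  then obtain x where x: "x \<in> carrier A" "\<And>e. e > 0 \<Longrightarrow> \<exists>N. \<forall>k\<ge>N. nrm A (r k \<ominus> x) < e"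
    by blast
  have "x \<in> B"
    by (rule closed_B) (use x r in blast)+
  then show "\<exists>x\<in>carrier T. \<forall>e>0. \<exists>N. \<forall>k\<ge>N. nrm T (s k \<ominus>\<^bsub>T\<^esub> x) < e"
    using x(2) r by (auto intro!: bexI[of _ "f x"] simp: minus_T)
qed

lemma state_T: "faithful_tracial_state T (\<tau> \<circ> g)"
proof (intro faithful_tracial_state.intro cstar_T faithful_tracial_state_axioms.intro)
  fix x y assume "x \<in> carrier T" "y \<in> carrier T"
  then show "(\<tau> \<circ> g) (x \<otimes>\<^bsub>T\<^esub> y) = (\<tau> \<circ> g) (y \<otimes>\<^bsub>T\<^esub> x)"
    using trace_comm by auto
qed (auto simp: trace_add trace_smult trace_pos trace_one trace_faithful)

end

text \<open>Terms denoting the elements of the *-subalgebra over the Gaussian rationals generated by a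
  sequence of elements.\<close>

datatype star_term =
  Gen nat | Zero | One | Add star_term star_term | Mul star_term star_term
  | Scale rat rat star_term | Adj star_term

instance star_term :: countable
  by countable_datatype

primrec eval_term :: "('a, 'm) star_struct_scheme \<Rightarrow> (nat \<Rightarrow> 'a) \<Rightarrow> star_term \<Rightarrow> 'a" where
  "eval_term A u (Gen i) = u i"
| "eval_term A u Zero = \<zero>\<^bsub>A\<^esub>"
| "eval_term A u One = \<one>\<^bsub>A\<^esub>"
| "eval_term A u (Add s t) = eval_term A u s \<oplus>\<^bsub>A\<^esub> eval_term A u t"
| "eval_term A u (Mul s t) = eval_term A u s \<otimes>\<^bsub>A\<^esub> eval_term A u t"
| "eval_term A u (Scale p q t) = Complex (of_rat p) (of_rat q) \<odot>\<^bsub>A\<^esub> eval_term A u t"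
| "eval_term A u (Adj t) = adj A (eval_term A u t)"

lemma gaussian_rational_approx:
  assumes "0 < e"
  shows "\<exists>p q. cmod (c - Complex (of_rat p) (of_rat q)) < e"
proof -
  obtain p where p: "Re c < of_rat p" "of_rat p < Re c + e/2"
    using of_rat_dense[of "Re c" "Re c + e/2"] assms by auto
  obtain q where q: "Im c < of_rat q" "of_rat q < Im c + e/2"
    using of_rat_dense[of "Im c" "Im c + e/2"] assms by auto
  have "cmod (c - Complex (of_rat p) (of_rat q)) \<le> \<bar>Re c - of_rat p\<bar> + \<bar>Im c - of_rat q\<bar>"
    using cmod_le[of "c - Complex (of_rat p) (of_rat q)"] by simp
  also have "\<dots> < e" using p q by linarith
  finally show ?thesis by blast
qed

lemma small_product:
  fixes a b e :: real
  assumes "0 \<le> a" "0 \<le> b" "0 < e"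
  shows "\<exists>d>0. \<forall>r s. 0 \<le> r \<longrightarrow> r < d \<longrightarrow> 0 \<le> s \<longrightarrow> s < d \<longrightarrow> r * b + (a + r) * s < e"
proof -
  define d where "d = min 1 (e / (a + b + 2))"
  have d: "0 < d" "d \<le> 1" "d * (a + b + 2) \<le> e"
    using assms by (auto simp: d_def pos_le_divide_eq[symmetric])
  have "r * b + (a + r) * s < e" if "0 \<le> r" "r < d" "0 \<le> s" "s < d" for r s
  proof -
    have "r * b \<le> d * b" "(a + r) * s \<le> (a + 1) * d"
      using that assms d by (auto intro!: mult_mono)
    with d assms show ?thesis by (auto simp: algebra_simps)
  qed
  with d show ?thesis by blast
qed

locale generated = faithful_tracial_state A \<tau>
  for A :: "('a, 'm) star_struct_scheme" (structure) and \<tau> +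
  fixes u :: "nat \<Rightarrow> 'a"
  assumes gen [simp]: "u i \<in> carrier A"
begin

abbreviation "ev \<equiv> eval_term A u"

definition "cl = {x \<in> carrier A. \<forall>e>0. \<exists>t. nrm A (x \<ominus> ev t) < e}"

definition "emb x = (\<lambda>k. nrm A (x \<ominus> ev (from_nat k)))"

lemma ev_closed [simp]: "ev t \<in> carrier A"
  by (induction t) auto

lemma clI: "\<lbrakk>x \<in> carrier A; \<And>e. e > 0 \<Longrightarrow> \<exists>t. nrm A (x \<ominus> ev t) < e\<rbrakk> \<Longrightarrow> x \<in> cl"
  by (auto simp: cl_def)

lemma clD:
  assumes "x \<in> cl" "0 < e"
  obtains t where "nrm A (x \<ominus> ev t) < e"
  using assms by (auto simp: cl_def)

lemma cl_carrier [simp]: "x \<in> cl \<Longrightarrow> x \<in> carrier A"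
  by (auto simp: cl_def)

lemma ev_cl: "ev t \<in> cl"
  by (rule clI, simp) (rule exI[of _ t], simp add: a_minus_def r_neg iffD2[OF nrm_eq_0])

lemma emb_inj: "inj_on emb cl"
proof (rule inj_onI)
  fix x y assume x: "x \<in> cl" and y: "y \<in> cl" and eq: "emb x = emb y"
  have same: "nrm A (x \<ominus> ev t) = nrm A (y \<ominus> ev t)" for t
    using fun_cong[OF eq, of "to_nat t"] by (simp add: emb_def)
  have "nrm A (x \<ominus> y) \<le> e" if e: "0 < e" for e
  proof -
    obtain t where t: "nrm A (x \<ominus> ev t) < e/2" using clD[OF x, of "e/2"] e by auto
    have "nrm A (x \<ominus> y) \<le> nrm A (x \<ominus> ev t) + nrm A (ev t \<ominus> y)"
      using x y by (intro nrm_sub_triangle) auto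
    then show ?thesis using t same[of t] nrm_sub_commute[of "ev t" y] y by simp
  qed
  then have "nrm A (x \<ominus> y) \<le> 0" by (meson field_le_epsilon add_0 order.trans dense_ge)
  then have "x \<ominus> y = \<zero>" using nrm_nonneg[of "x \<ominus> y"] nrm_eq_0[of "x \<ominus> y"] x y by simp
  then have "y \<oplus> (x \<ominus> y) = y" using y by simp
  then show "x = y" using x y by (simp add: a_minus_def a_lcomm r_neg)
qed

lemma add_cl: assumes x: "x \<in> cl" and y: "y \<in> cl" shows "x \<oplus> y \<in> cl"
proof (rule clI)
  fix e :: real assume e: "0 < e"
  obtain s where s: "nrm A (x \<ominus> ev s) < e/2" using clD[OF x, of "e/2"] e by auto
  obtain t where t: "nrm A (y \<ominus> ev t) < e/2" using clD[OF y, of "e/2"] e by auto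
  show "\<exists>t. nrm A (x \<oplus> y \<ominus> ev t) < e"
    using s t nrm_add_sub_add[of x y "ev s" "ev t"] x y by (intro exI[of _ "Add s t"]) simp
qed (use assms in simp)

lemma mult_cl: assumes x: "x \<in> cl" and y: "y \<in> cl" shows "x \<otimes> y \<in> cl"
proof (rule clI)
  fix e :: real assume e: "0 < e"
  obtain d where d: "d > 0" "\<And>r s. \<lbrakk>0 \<le> r; r < d; 0 \<le> s; s < d\<rbrakk> \<Longrightarrow> 
      r * nrm A y + (nrm A x + r) * s < e"
    using small_product[of "nrm A x" "nrm A y" e] nrm_nonneg x y e by force
  obtain s where s: "nrm A (x \<ominus> ev s) < d" using clD[OF x d(1)] by auto
  obtain t where t: "nrm A (y \<ominus> ev t) < d" using clD[OF y d(1)] by auto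
  have "nrm A (x \<otimes> y \<ominus> ev (Mul s t)) < e"
    using nrm_mult_sub_mult[of x y "ev s" "ev t"]
      d(2)[OF nrm_nonneg s nrm_nonneg t] x y by simp
  then show "\<exists>t. nrm A (x \<otimes> y \<ominus> ev t) < e" ..
qed (use assms in simp)

lemma smult_cl: assumes x: "x \<in> cl" shows "c \<odot> x \<in> cl"
proof (rule clI)
  fix e :: real assume e: "0 < e"
  obtain d where d: "d > 0" "\<And>r s. \<lbrakk>0 \<le> r; r < d; 0 \<le> s; s < d\<rbrakk> \<Longrightarrow> 
      r * nrm A x + (cmod c + r) * s < e"
    using small_product[of "cmod c" "nrm A x" e] nrm_nonneg x e by force
  obtain p q where pq: "cmod (c - Complex (of_rat p) (of_rat q)) < d"
    using gaussian_rational_approx[OF d(1)] by blast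
  obtain t where t: "nrm A (x \<ominus> ev t) < d" using clD[OF x d(1)] by auto
  have "nrm A (c \<odot> x \<ominus> ev (Scale p q t)) < e"
    using nrm_smult_sub_smult[of x "ev t" c "Complex (of_rat p) (of_rat q)"]
      d(2)[OF norm_ge_zero pq nrm_nonneg t] x by simp
  then show "\<exists>t. nrm A (c \<odot> x \<ominus> ev t) < e" ..
qed (use assms in simp)

lemma adj_cl: assumes x: "x \<in> cl" shows "adj A x \<in> cl"
proof (rule clI)
  fix e :: real assume e: "0 < e"
  obtain t where t: "nrm A (x \<ominus> ev t) < e" using clD[OF x e] by auto
  have "adj A x \<ominus> ev (Adj t) = adj A (x \<ominus> ev t)"
    using x by (simp add: a_minus_def adj_add adj_minus)
  then have "nrm A (adj A x \<ominus> ev (Adj t)) < e"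
    using t x nrm_adj[of "x \<ominus> ev t"] by simp
  then show "\<exists>t. nrm A (adj A x \<ominus> ev t) < e" ..
qed (use assms in simp)

lemma closed_cl:
  assumes x: "x \<in> carrier A" and lim: "\<And>e. 0 < e \<Longrightarrow> \<exists>y\<in>cl. nrm A (y \<ominus> x) < e"
  shows "x \<in> cl"
proof (rule clI)
  fix e :: real assume e: "0 < e"
  obtain y where y: "y \<in> cl" "nrm A (y \<ominus> x) < e/2" using lim[of "e/2"] e by auto
  obtain t where t: "nrm A (y \<ominus> ev t) < e/2" using clD[OF y(1), of "e/2"] e by auto
  have "nrm A (x \<ominus> ev t) < e"
    using nrm_sub_triangle[of x y "ev t"] nrm_sub_commute[of x y] x y t by simp
  then show "\<exists>t. nrm A (x \<ominus> ev t) < e" ..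
qed (use x in simp)

sublocale cl: closed_star_subalgebra A \<tau> cl emb
proof unfold_locales
  show "\<zero> \<in> cl" using ev_cl[of Zero] by simp
  show "\<one> \<in> cl" using ev_cl[of One] by simp
qed (auto intro: emb_inj add_cl mult_cl smult_cl adj_cl closed_cl)

end

theorem moment_mat_in_unitary_moments:
  fixes A :: "('a, 'm) star_struct_scheme"
  assumes "faithful_tracial_state A \<tau>" and U: "\<And>i. i < n \<Longrightarrow> U i \<in> unitaries A"
  shows "moment_mat A \<tau> n U \<in> unitary_moments n"
proof -
  interpret faithful_tracial_state A \<tau> by fact
  define u where "u i = (if i < n then U i else \<one>\<^bsub>A\<^esub>)" for i
  have u: "u i \<in> unitaries A" for i
    using U by (auto simp: u_def unitaries_def adj_one)
  interpret generated A \<tau> u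
    using u by unfold_locales (auto simp: unitaries_def)
  have [simp]: "u i \<in> cl" for i using ev_cl[of "Gen i"] by simp
  have "moment_mat A \<tau> n U = moment_mat cl.T (\<tau> \<circ> cl.g) n (emb \<circ> u)"
    by (auto simp: moment_mat_def u_def[symmetric] intro!: eq_matI) (simp add: u_def)
  moreover have "(emb \<circ> u) i \<in> unitaries cl.T" for i
    using u[of i] by (auto simp: unitaries_def)
  ultimately show ?thesis
    unfolding unitary_moments_def using cl.state_T by blast
qed

end

theory Submission
  imports Defs
begin

text \<open>Take the Gram matrix of the vectors \<open>e\<^sub>1\<close>, \<open>e\<^sub>2\<close>, \<open>(e\<^sub>1 + e\<^sub>2) / \<surd>2\<close>, \<open>(e\<^sub>1 + \<i> e\<^sub>2) / \<surd>2\<close> of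
  \<open>\<complex>\<^sup>2\<close>. If unitaries \<open>u, v, w, z\<close> had these moments, faithfulness of the trace would force
  the same linear relations \<open>w = (u + v) / \<surd>2\<close> and \<open>z = (u + \<i> v) / \<surd>2\<close>. Unitarity of \<open>w\<close>
  makes \<open>u\<^sup>* v\<close> skew-adjoint and unitarity of \<open>z\<close> makes it self-adjoint, so the unitary \<open>u\<^sup>* v\<close>
  would vanish.\<close>

lemma positive_semidefinite_gram:
  fixes v :: "nat \<Rightarrow> nat \<Rightarrow> complex"
  shows "positive_semidefinite n (mat n n (\<lambda>(i, j). \<Sum>k<m. cnj (v i k) * v j k))"
    (is "positive_semidefinite n ?X")
  unfolding positive_semidefinite_def
proof (intro conjI ballI)
  fix w :: "complex vec" assume w: "w \<in> carrier_vec n"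
  \<comment> \<open>\<open>y\<close> is the combination of the vectors \<open>v j\<close> with
    coefficients \<open>w $ j\<close>; the quadratic form turns out to be its squared norm.\<close>
  define y where "y k = (\<Sum>j<n. v j k * w $ j)" for k
  have "(?X *\<^sub>v w) \<bullet>c w = (\<Sum>i<n. (\<Sum>j<n. (\<Sum>k<m. cnj (v i k) * v j k) * w $ j) * cnj (w $ i))"
    using w by (auto simp: scalar_prod_def atLeast0LessThan intro!: sum.cong)
  also have "\<dots> = (\<Sum>i<n. \<Sum>j<n. \<Sum>k<m. cnj (v i k * w $ i) * (v j k * w $ j))"
    by (simp add: sum_distrib_left sum_distrib_right mult_ac)
  also have "\<dots> = (\<Sum>i<n. \<Sum>k<m. \<Sum>j<n. cnj (v i k * w $ i) * (v j k * w $ j))"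
    by (intro sum.cong refl sum.swap)
  also have "\<dots> = (\<Sum>k<m. \<Sum>i<n. \<Sum>j<n. cnj (v i k * w $ i) * (v j k * w $ j))"
    by (rule sum.swap)
  also have "\<dots> = (\<Sum>k<m. cnj (y k) * y k)"
    by (simp only: y_def cnj_sum sum_product)
  also have "0 \<le> \<dots>"
    by (intro sum_nonneg) (simp add: less_eq_complex_def)
  finally show "0 \<le> (?X *\<^sub>v w) \<bullet>c w" .
qed simp

context faithful_tracial_state
begin

text \<open>Polarization: positivity makes \<open>\<tau>\<close> real on squares, and the squares of
  \<open>x \<oplus> y\<close> and \<open>x \<oplus> \<i> \<odot> y\<close> settle the imaginary and
  the real part.\<close>

lemma trace_adj_mult_cnj:
  assumes [simp]: "x \<in> carrier A" "y \<in> carrier A"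
  shows "\<tau> (adj A y \<otimes> x) = cnj (\<tau> (adj A x \<otimes> y))"
proof -
  have real: "Im (\<tau> (adj A z \<otimes> z)) = 0" if "z \<in> carrier A" for z
    using trace_pos[OF that] by (simp add: less_eq_complex_def)
  have "Im (\<tau> (adj A x \<otimes> y)) + Im (\<tau> (adj A y \<otimes> x)) = 0"
    using real[of "x \<oplus> y"] real[of x] real[of y]
    by (simp add: adj_add l_distr r_distr trace_add)
  \<comment> \<open>The cross terms of this square are \<open>\<i>\<close> times the difference of
    the two traces.\<close>
  moreover have "Re (\<tau> (adj A x \<otimes> y)) = Re (\<tau> (adj A y \<otimes> x))"
    using real[of "x \<oplus> \<i> \<odot> y"] real[of x] real[of y]
    by (simp add: adj_add adj_smult l_distr r_distr smult_mult_l smult_mult_r trace_add trace_smult)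
  ultimately show ?thesis by (simp add: complex_eq_iff)
qed

lemma unitary_trace_square:
  assumes "u \<in> unitaries A"
  shows "\<tau> (adj A u \<otimes> u) = 1"
  using assms by (simp add: unitaries_def trace_one)

text \<open>Equality case of Bessel's inequality for the inner product
  \<open>\<tau> (adj A x \<otimes> y)\<close>, in which \<open>u\<close> and \<open>v\<close> are
  orthonormal: the residual of \<open>w\<close> has norm zero, so it vanishes by
  faithfulness.\<close>

lemma unitary_eq_lincomb:
  assumes u: "u \<in> unitaries A" and v: "v \<in> unitaries A" and w: "w \<in> unitaries A"
    and uv: "\<tau> (adj A u \<otimes> v) = 0"
    and ab: "cmod (\<tau> (adj A u \<otimes> w)) ^ 2 + cmod (\<tau> (adj A v \<otimes> w)) ^ 2 = 1"
  shows "w = \<tau> (adj A u \<otimes> w) \<odot> u \<oplus> \<tau> (adj A v \<otimes> w) \<odot> v"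
proof -
  define a b where "a = \<tau> (adj A u \<otimes> w)" and "b = \<tau> (adj A v \<otimes> w)"
  have [simp]: "u \<in> carrier A" "v \<in> carrier A" "w \<in> carrier A"
    using u v w by (auto simp: unitaries_def)
  define r where "r = w \<oplus> ((- a) \<odot> u \<oplus> (- b) \<odot> v)"
  have [simp]: "\<tau> (adj A v \<otimes> u) = 0" "\<tau> (adj A w \<otimes> u) = cnj a" "\<tau> (adj A w \<otimes> v) = cnj b"
    using trace_adj_mult_cnj[of u v] trace_adj_mult_cnj[of u w] trace_adj_mult_cnj[of v w] uv
    by (simp_all add: a_def b_def)
  have ab': "a * cnj a + b * cnj b = 1"
    using ab unfolding a_def[symmetric] b_def[symmetric] complex_norm_square[symmetric]
    by (simp flip: of_real_add of_real_power)
  have "\<tau> (adj A r \<otimes> r) = 1 - (a * cnj a + b * cnj b)"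
    by (simp add: r_def adj_add adj_smult l_distr r_distr smult_mult_l smult_mult_r trace_add
        trace_smult uv unitary_trace_square u v w a_def[symmetric] b_def[symmetric])
  then have "r = \<zero>"
    using ab' by (intro trace_faithful) (auto simp: r_def)
  then have "w = \<ominus> ((- a) \<odot> u \<oplus> (- b) \<odot> v)"
    unfolding r_def by (intro minus_equality[symmetric]) simp_all
  also have "\<dots> = a \<odot> u \<oplus> b \<odot> v"
    by (simp add: minus_smult smult_r_distr flip: smult_assoc)
  finally show ?thesis by (simp add: a_def b_def)
qed

text \<open>Multiply \<open>w\<^sup>* w = \<one>\<close> by \<open>v\<^sup>* u\<close> and take the trace.\<close>

lemma unitary_lincomb_trace:
  assumes u: "u \<in> unitaries A" and v: "v \<in> unitaries A" and w: "w \<in> unitaries A"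
    and uv: "\<tau> (adj A u \<otimes> v) = 0" and w_eq: "w = a \<odot> u \<oplus> b \<odot> v"
  shows "cnj a * b + a * cnj b * \<tau> ((adj A v \<otimes> u) \<otimes> (adj A v \<otimes> u)) = 0"
proof -
  have [simp]: "u \<in> carrier A" "v \<in> carrier A" "w \<in> carrier A"
    "adj A u \<otimes> u = \<one>" "adj A v \<otimes> v = \<one>" "u \<otimes> adj A u = \<one>"
    using u v w by (auto simp: unitaries_def)
  define q where "q = adj A v \<otimes> u"
  have [simp]: "q \<in> carrier A" and q0: "\<tau> q = 0"
    using trace_adj_mult_cnj[of u v] uv by (simp_all add: q_def)
  have "u \<otimes> (adj A u \<otimes> v) = v"
    by (simp flip: m_assoc)
  then have quv: "q \<otimes> (adj A u \<otimes> v) = \<one>"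
    by (simp add: q_def m_assoc)
  have "adj A w \<otimes> w = (a * cnj a) \<odot> \<one> \<oplus> (b * cnj a) \<odot> (adj A u \<otimes> v)
      \<oplus> ((a * cnj b) \<odot> q \<oplus> (b * cnj b) \<odot> \<one>)"
    by (simp add: w_eq q_def adj_add adj_smult l_distr r_distr smult_mult_l smult_mult_r smult_r_distr
        smult_assoc a_ac)
  moreover have "adj A w \<otimes> w = \<one>"
    using w by (simp add: unitaries_def)
  ultimately have "\<tau> q = \<tau> (q \<otimes> ((a * cnj a) \<odot> \<one> \<oplus> (b * cnj a) \<odot> (adj A u \<otimes> v)
      \<oplus> ((a * cnj b) \<odot> q \<oplus> (b * cnj b) \<odot> \<one>)))"
    by simp
  \<comment> \<open>The multiples of \<open>\<one>\<close> drop out because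
    \<open>\<tau> q = 0\<close>.\<close>
  also have "\<dots> = b * cnj a + a * cnj b * \<tau> (q \<otimes> q)"
    by (simp add: r_distr smult_mult_r trace_add trace_smult quv q0 trace_one)
  finally show ?thesis
    unfolding q_def[symmetric] by (simp add: q0 mult.commute)
qed

end

theorem corollary2p11:
  shows "unitary_moments 4 \<noteq> correlation_matrices 4"
proof
  assume eq: "unitary_moments 4 = correlation_matrices 4"
  define s where "s = complex_of_real (1 / sqrt 2)"
  have ss: "s * s = 1 / 2" and cs: "cnj s = s"
    by (simp_all add: s_def flip: of_real_mult)
  \<comment> \<open>Needed for the last diagonal entry, as
    \<open>cnj (s * \<i>) = - (s * \<i>)\<close>.\<close>
  have sis: "s * \<i> * (s * \<i>) = - (1 / 2)"
    using ss by (simp add: algebra_simps)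
  have norm_s: "(cmod s)\<^sup>2 = 1 / 2"
    by (simp add: s_def power_divide norm_divide)
  define v where "v i = [[1, 0], [0, 1], [s, s], [s, s * \<i>]] ! i" for i :: nat
  define X where "X = mat 4 4 (\<lambda>(i, j). \<Sum>k<2. cnj (v i ! k) * v j ! k)"
  have X: "X $$ (i, j) = cnj (v i ! 0) * v j ! 0 + cnj (v i ! 1) * v j ! 1"
    if "i < 4" "j < 4" for i j
    using that by (simp add: X_def numeral_2_eq_2)
  have "X $$ (i, i) = 1" if "i < 4" for i
  proof -
    have "i = 0 \<or> i = 1 \<or> i = 2 \<or> i = 3" using that by auto
    then show ?thesis by (auto simp: X v_def cs ss sis)
  qed
  then have "X \<in> correlation_matrices 4"
    unfolding correlation_matrices_def X_def by (auto intro: positive_semidefinite_gram)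
  then obtain A :: "(nat \<Rightarrow> real) star_struct" and \<tau> U
    where XU: "X = moment_mat A \<tau> 4 U" and "faithful_tracial_state A \<tau>"
      and U: "\<And>i. i < 4 \<Longrightarrow> U i \<in> unitaries A"
    unfolding eq[symmetric] unitary_moments_def by blast
  interpret faithful_tracial_state A \<tau> by fact
  have mom: "\<tau> (adj A (U i) \<otimes>\<^bsub>A\<^esub> U j) = cnj (v i ! 0) * v j ! 0 + cnj (v i ! 1) * v j ! 1"
    if "i < 4" "j < 4" for i j
    using X[OF that] that by (simp add: XU moment_mat_def)
  have 01: "\<tau> (adj A (U 0) \<otimes>\<^bsub>A\<^esub> U 1) = 0"
    and 2: "\<tau> (adj A (U 0) \<otimes>\<^bsub>A\<^esub> U 2) = s" "\<tau> (adj A (U 1) \<otimes>\<^bsub>A\<^esub> U 2) = s"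
    and 3: "\<tau> (adj A (U 0) \<otimes>\<^bsub>A\<^esub> U 3) = s" "\<tau> (adj A (U 1) \<otimes>\<^bsub>A\<^esub> U 3) = s * \<i>"
    by (subst mom; simp add: v_def)+
  \<comment> \<open>A single scalar detects the contradiction: a skew-adjoint unitary has square
    \<open>-1\<close>, a self-adjoint one has square \<open>1\<close>, so \<open>t\<close> would be
    both \<open>-1\<close> and \<open>1\<close>.\<close>
  define t where "t = \<tau> ((adj A (U 1) \<otimes>\<^bsub>A\<^esub> U 0) \<otimes>\<^bsub>A\<^esub> (adj A (U 1) \<otimes>\<^bsub>A\<^esub> U 0))"
  have U2: "U 2 = s \<odot>\<^bsub>A\<^esub> U 0 \<oplus>\<^bsub>A\<^esub> s \<odot>\<^bsub>A\<^esub> U 1"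
    using unitary_eq_lincomb[of "U 0" "U 1" "U 2"] U 01 2 norm_s by simp
  have "cnj s * s + s * cnj s * t = 0"
    unfolding t_def by (intro unitary_lincomb_trace[OF _ _ _ 01 U2] U) simp_all
  then have "s * s * (1 + t) = 0"
    by (simp add: cs algebra_simps)
  then have "1 + t = 0"
    by (simp add: ss)
  have U3: "U 3 = s \<odot>\<^bsub>A\<^esub> U 0 \<oplus>\<^bsub>A\<^esub> (s * \<i>) \<odot>\<^bsub>A\<^esub> U 1"
    using unitary_eq_lincomb[of "U 0" "U 1" "U 3"] U 01 3 norm_s by (simp add: norm_mult)
  \<comment> \<open>Conjugating the factor \<open>\<i>\<close> flips the relative sign of the two
    terms.\<close>
  have "cnj s * (s * \<i>) + s * cnj (s * \<i>) * t = 0"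
    unfolding t_def by (intro unitary_lincomb_trace[OF _ _ _ 01 U3] U) simp_all
  then have "(s * s) * \<i> * (1 - t) = 0"
    by (simp add: cs algebra_simps)
  then have "1 - t = 0"
    by (simp add: ss)
  with \<open>1 + t = 0\<close> show False
    by (simp add: add_eq_0_iff)
qed

end
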